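(* Let $t\ge 1$ be an integer and $\rho>0$ a real number, and let $\{\mathbf{y}_n\}_{n\in\mathbb{N}}$ be a fixed enumeration of the layered codebook as described in the context. For $P>0$ let $\mathsf{Q}^\star=\mathsf{Q}^\star_P=\{(\mathbf{y}_n,\mathcal{F}_n,\mathsf{b}^\star_n)\}_{n\in\mathbb{N}}$ be the variable-length quantizer defined in the context. Then there is a constant $C_0$, independent of $P$, such that for every $P>0$, $$\mathrm{OUT}(\mathsf{Q}^\star)=\mathrm{OUT}(\mathrm{Full})\qquad\text{and}\qquad \mathrm{R}(\mathsf{Q}^\star)\le C_0\left(\frac1P+\frac1{P^t}\right).$$
   Context: $\mathbb{N}=\{0,1,2,\dots\}$. The channel state $\mathbf{h}=(h_1,\dots,h_t)^T\in\mathbb{C}^t$ is a random vector with i.i.d. standard circularly symmetric complex Gaussian entries $h_i\sim\mathcal{CN}(0,1)$, i.e. with density $\pi^{-t}e^{-\|\mathbf{h}\|^2}$ on $\mathbb{C}^t$. $\langle\cdot,\cdot\rangle$ is the standard Hermitian inner product and $\|\cdot\|$ the Euclidean norm on $\mathbb{C}^t$. $P>0$ is the transmit power, $\rho>0$ the target rate, and $\alpha=(2^\rho-1)/P$. The set of beamforming vectors is $\mathcal{X}_{\mathrm{BF}}=\{\mathbf{x}\in\mathbb{C}^t:\|\mathbf{x}\|=1\}$. A quantizer is a collection of triples $\mathsf{Q}=\{(\mathbf{x}_n,\mathcal{E}_n,\mathsf{b}_n)\}_{n\in\mathcal{I}}$, $\mathcal{I}\subset\mathbb{N}$, where $\mathbf{x}_n\in\mathcal{X}_{\mathrm{BF}}$,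 the $\mathcal{E}_n$ are mutually disjoint measurable subsets of $\mathbb{C}^t$ with union $\mathbb{C}^t$, and the $\mathsf{b}_n$ are distinct binary words (the empty word is allowed; no prefix-free condition is imposed). One writes $\mathsf{Q}(\mathbf{h})=\mathbf{x}_n$ if $\mathbf{h}\in\mathcal{E}_n$. The outage probability of $\mathsf{Q}$ is $\mathrm{OUT}(\mathsf{Q})=\Pr(|\langle\mathsf{Q}(\mathbf{h}),\mathbf{h}\rangle|^2<\alpha)$, and its rate is $\mathrm{R}(\mathsf{Q})=\sum_{n\in\mathcal{I}}\Pr(\mathbf{h}\in\mathcal{E}_n)\,\mathrm{L}(\mathsf{b}_n)$, where $\mathrm{L}(\mathsf{b})$ is the length of the word $\mathsf{b}$ (the empty word has length $0$). The full-CSIT outage probability is $\mathrm{OUT}(\mathrm{Full})=\Pr(\|\mathbf{h}\|^2<\alpha)$. Layered codebook: for $\ell\in\mathbb{N}$ let $\mathcal{S}_\ell=\{-1+\tfrac{k}{2^{\ell+1}}:k=1,\dots,2^{\ell+2}-1\}$ and $$\mathcal{Y}_\ell=\left\{\frac{\mathbf{y}}{\|\mathbf{y}\|}:\ \mathbf{y}\in\mathbb{C}^t,\ \Re y_i\in\mathcal{S}_\ell,\ \Im y_i\in\mathcal{S}_\ell\ (i=1,\dots,t),\ 0<\|\mathbf{y}\|\le1\right\}.$$ Each $\mathcal{Y}_\ell$ is finite and $\mathcal{Y}_\ell\subset\mathcal{Y}_{\ell+1}$, so one can fix a sequence $\{\mathbf{y}_n\}_{n\in\mathbb{N}}$ (not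 depending on $P$) such that $\{\mathbf{y}_0,\dots,\mathbf{y}_{|\mathcal{Y}_\ell|-1}\}=\mathcal{Y}_\ell$ for every $\ell\in\mathbb{N}$. Encoding regions: for $\mathbf{x}\in\mathcal{X}_{\mathrm{BF}}$ let $\mathcal{O}_{\mathbf{x}}=\{\mathbf{h}\in\mathbb{C}^t:|\langle\mathbf{x},\mathbf{h}\rangle|<\sqrt{\alpha}\}$, with complement $\mathcal{O}_{\mathbf{x}}^c$. Set $$\mathcal{F}_0=\mathcal{O}_{\mathbf{y}_0}^c\cup\bigcap_{n\in\mathbb{N}}\mathcal{O}_{\mathbf{y}_n},\qquad \mathcal{F}_n=\mathcal{O}_{\mathbf{y}_n}^c\cap\bigcap_{k=0}^{n-1}\mathcal{O}_{\mathbf{y}_k}\quad(n\ge1).$$ Binary codewords: $\mathsf{b}^\star_0,\mathsf{b}^\star_1,\mathsf{b}^\star_2,\dots$ is the enumeration $\epsilon,0,1,00,01,10,11,000,\dots$ of all finite binary words ($\epsilon$ the empty word), so that $\mathrm{L}(\mathsf{b}^\star_n)=\lfloor\log_2(n+1)\rfloor$. *)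

theory Defs
  imports "HOL-Probability.Probability"
begin

text \<open>The law of the channel state: the density \<open>\<pi>\<^sup>-\<^sup>t exp (-\<parallel>h\<parallel>\<^sup>2)\<close> with respect to
  Lebesgue measure on \<open>complex ^ 't\<close>, regarded as a real Euclidean space of dimension
  \<open>2 * CARD('t)\<close>. The library norm on \<open>complex ^ 't\<close> is the Euclidean (Hermitian) norm.\<close>

definition channel :: "(complex ^ 't) measure" where
  "channel = density lborel (\<lambda>h. ennreal (exp (- (norm h)\<^sup>2) / pi ^ CARD('t)))"

definition hinner :: "complex ^ 't \<Rightarrow> complex ^ 't \<Rightarrow> complex" where
  "hinner x h = (\<Sum>i\<in>UNIV. x $ i * cnj (h $ i))"

definition snr_threshold :: "real \<Rightarrow> real \<Rightarrow> real" where
  "snr_threshold \<rho> P = (2 powr \<rho> - 1) / P"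

definition beamformers :: "(complex ^ 't) set" where
  "beamformers = {x. norm x = 1}"

text \<open>Binary words are Boolean lists, with \<open>False\<close> for the digit 0 and \<open>True\<close> for 1.\<close>

record ('t::finite) quantizer =
  index :: "nat set"
  beam :: "nat \<Rightarrow> complex ^ 't"
  region :: "nat \<Rightarrow> (complex ^ 't) set"
  codeword :: "nat \<Rightarrow> bool list"

definition is_quantizer :: "('t::finite) quantizer \<Rightarrow> bool" where
  "is_quantizer Q \<longleftrightarrow>
     (\<forall>n\<in>index Q. beam Q n \<in> beamformers) \<and>
     (\<forall>n\<in>index Q. region Q n \<in> sets borel) \<and>
     disjoint_family_on (region Q) (index Q) \<and>
     (\<Union>n\<in>index Q. region Q n) = UNIV \<and>
     inj_on (codeword Q) (index Q)"

definition quantize :: "('t::finite) quantizer \<Rightarrow> complex ^ 't \<Rightarrow> complex ^ 't" where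
  "quantize Q h = beam Q (THE n. n \<in> index Q \<and> h \<in> region Q n)"

definition outage :: "real \<Rightarrow> ('t::finite) quantizer \<Rightarrow> real" where
  "outage \<alpha> Q = measure channel {h. (cmod (hinner (quantize Q h) h))\<^sup>2 < \<alpha>}"

definition outage_full :: "'t::finite itself \<Rightarrow> real \<Rightarrow> real" where
  "outage_full _ \<alpha> = measure channel {h :: complex ^ 't. (norm h)\<^sup>2 < \<alpha>}"

text \<open>The rate is a possibly infinite sum of nonnegative terms. It takes values in
  \<open>ennreal\<close>, where every such sum exists, so that a finite upper bound includes convergence.\<close>

definition rate :: "('t::finite) quantizer \<Rightarrow> ennreal" where
  "rate Q = (\<Sum>\<^sub>\<infinity>n\<in>index Q. emeasure channel (region Q n) * of_nat (length (codeword Q n)))"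

definition grid :: "nat \<Rightarrow> real set" where
  "grid l = (\<lambda>k::nat. - 1 + real k / 2 ^ (l + 1)) ` {1 .. 2 ^ (l + 2) - 1}"

definition layer :: "nat \<Rightarrow> (complex ^ 't) set" where
  "layer l = {y /\<^sub>R norm y | y.
     (\<forall>i. Re (y $ i) \<in> grid l \<and> Im (y $ i) \<in> grid l) \<and> 0 < norm y \<and> norm y \<le> 1}"

text \<open>The condition makes \<open>y\<close> injective, since \<open>card (layer l)\<close> indices cover
  \<open>layer l\<close> and the cardinalities are unbounded.\<close>

definition layered_enumeration :: "(nat \<Rightarrow> complex ^ 't) \<Rightarrow> bool" where
  "layered_enumeration y \<longleftrightarrow> (\<forall>l. y ` {..<card (layer l :: (complex ^ 't) set)} = layer l)"

definition outage_region :: "real \<Rightarrow> complex ^ 't \<Rightarrow> (complex ^ 't) set" where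
  "outage_region \<alpha> x = {h. cmod (hinner x h) < sqrt \<alpha>}"

definition encoding_region ::
    "real \<Rightarrow> (nat \<Rightarrow> complex ^ 't) \<Rightarrow> nat \<Rightarrow> (complex ^ 't) set" where
  "encoding_region \<alpha> y n =
     (if n = 0 then - outage_region \<alpha> (y 0) \<union> (\<Inter>k. outage_region \<alpha> (y k))
      else - outage_region \<alpha> (y n) \<inter> (\<Inter>k<n. outage_region \<alpha> (y k)))"

text \<open>The \<open>n\<close>-th binary word in order of length and then lexicographically: the binary
  expansion of \<open>n + 1\<close> without its leading digit 1.\<close>

fun bword :: "nat \<Rightarrow> bool list" where
  "bword 0 = []"
| "bword (Suc n) = bword (n div 2) @ [odd n]"

definition vlq :: "real \<Rightarrow> (nat \<Rightarrow> complex ^ 't) \<Rightarrow> ('t::finite) quantizer" where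
  "vlq \<alpha> y = \<lparr>index = UNIV, beam = y, region = encoding_region \<alpha> y, codeword = bword\<rparr>"

lemma prob_space_channel: "prob_space (channel :: (complex ^ 't) measure)"
proof
  let ?f = "\<lambda>x::real. exp (- x\<^sup>2) / sqrt pi"
  have nd: "normal_density 0 (1 / sqrt 2) x = ?f x" for x
    by (simp add: normal_density_def power_divide real_sqrt_mult field_simps)
  have one: "(\<integral>\<^sup>+x. ennreal (?f x) \<partial>lborel) = 1"
  proof -
    have "emeasure (density lborel (\<lambda>x. ennreal (normal_density 0 (1 / sqrt 2) x))) UNIV = 1"
      using prob_space.emeasure_space_1[OF prob_space_normal_density[of "1 / sqrt 2" 0]] by simp
    then show ?thesis by (simp add: emeasure_density nd)
  qed
  have eq: "exp (- (norm h)\<^sup>2) / pi ^ CARD('t) = (\<Prod>b\<in>Basis. ?f (h \<bullet> b))" for h :: "complex ^ 't"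
  proof -
    have "(norm h)\<^sup>2 = (\<Sum>b\<in>Basis. (h \<bullet> b)\<^sup>2)"
      by (subst power2_norm_eq_inner, subst euclidean_inner) (simp add: power2_eq_square)
    then have "exp (- (norm h)\<^sup>2) = (\<Prod>b\<in>Basis. exp (- (h \<bullet> b)\<^sup>2))"
      by (simp add: exp_sum[symmetric] sum_negf)
    moreover have "pi ^ CARD('t) = sqrt pi ^ DIM(complex ^ 't)"
      by (simp add: power_mult[of "sqrt pi" 2 "CARD('t)", symmetric] power_mult mult.commute[of _ 2])
    ultimately show ?thesis by (simp only: prod_dividef prod_constant)
  qed
  have "emeasure channel (space (channel :: (complex ^ 't) measure))
      = (\<integral>\<^sup>+h. ennreal (exp (- (norm h)\<^sup>2) / pi ^ CARD('t)) \<partial>(lborel :: (complex ^ 't) measure))"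
    by (simp add: channel_def emeasure_density)
  also have "\<dots> = (\<integral>\<^sup>+h. (\<Prod>b\<in>Basis. ennreal (?f (h \<bullet> b))) \<partial>(lborel :: (complex ^ 't) measure))"
    by (subst eq, subst prod_ennreal[symmetric]) auto
  also have "\<dots> = (\<Prod>b\<in>(Basis :: (complex ^ 't) set). \<integral>\<^sup>+x. ennreal (?f x) \<partial>lborel)"
    by (rule nn_integral_lborel_prod) auto
  finally show "emeasure channel (space (channel :: (complex ^ 't) measure)) = 1"
    by (simp add: one)
qed

lemma length_bword: "length (bword n) = nat \<lfloor>log 2 (real (n + 1))\<rfloor>"
proof -
  have "2 ^ length (bword n) \<le> n + 1 \<and> n + 1 < 2 ^ (length (bword n) + 1)"
  proof (induction n rule: bword.induct)
    case (2 n)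
    define p :: nat where "p = 2 ^ length (bword (n div 2))"
    have "p \<le> n div 2 + 1" "n div 2 + 1 < 2 * p" using 2 by (auto simp: p_def)
    then have "2 * p \<le> Suc n + 1" "Suc n + 1 < 4 * p" by linarith+
    then show ?case by (simp add: p_def)
  qed simp
  then have "\<lfloor>log 2 (real (n + 1))\<rfloor> = int (length (bword n))"
    using floor_log_nat_eq_if[of 2 "length (bword n)" "n + 1"] by auto
  then show ?thesis by simp
qed

lemma bword_values:
  "map bword [0..<8] = [[], [False], [True], [False, False], [False, True],
     [True, False], [True, True], [False, False, False]]"
proof -
  have rec: "bword n = bword ((n - 1) div 2) @ [even n]" if "n > 0" for n
    using that by (cases n) auto
  have "[0..<8] = [0, 1, 2, 3, 4, 5, 6, 7::nat]" by (simp add: upt_rec)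
  then show ?thesis
    by (simp add: rec[of 1] rec[of "Suc 0"] rec[of 2] rec[of 3] rec[of 4] rec[of 5] rec[of 6]
        rec[of 7] del: bword.simps(2))
qed

lemma bij_bword: "bij bword"
proof -
  have "m = n" if "bword m = bword n" for m n
    using that
  proof (induction m arbitrary: n rule: bword.induct)
    case 1
    then show ?case by (cases n) auto
  next
    case (2 m)
    then obtain k where k: "n = Suc k" by (cases n) auto
    have "m div 2 = k div 2" "odd m = odd k" using 2 k by auto
    then show ?case using k by (metis even_two_times_div_two odd_two_times_div_two_succ)
  qed
  moreover have "\<exists>n. bword n = w" for w
  proof (induction w rule: rev_induct)
    case Nil
    show ?case by (rule exI[of _ 0]) simp
  next
    case (snoc b w)
    then obtain n where "bword n = w" by auto
    then have "bword (Suc (2 * n + of_bool b)) = w @ [b]" by (cases b) auto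
    then show ?case by blast
  qed
  ultimately show ?thesis unfolding bij_def inj_def surj_def by metis
qed

lemma layered_enumeration_beamformers:
  fixes y :: "nat \<Rightarrow> complex ^ 't"
  assumes "layered_enumeration y"
  shows "y n \<in> beamformers"
proof -
  let ?L = "layer n :: (complex ^ 't) set"
  have L: "y ` {..<card ?L} = ?L" using assms by (simp add: layered_enumeration_def)
  then have fin: "finite ?L" by (metis finite_imageI finite_lessThan)
  define j :: 't where "j = undefined"
  define s :: real where "s = 2 ^ (n + 1)"
  have s: "s > 0" by (simp add: s_def)
  define v :: "nat \<Rightarrow> complex ^ 't" where "v k = axis j (Complex (real k / s) (1 / s))" for k
  define u where "u k = v k /\<^sub>R norm (v k)" for k
  have grid: "real k / s \<in> grid n" if "k \<le> 2 ^ n" for k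
  proof -
    define p :: nat where "p = 2 ^ n"
    have "k \<le> p" "1 \<le> p" using that by (auto simp: p_def)
    then have "1 \<le> k + 2 * p" "k + 2 * p \<le> 4 * p - 1" by linarith+
    then have "k + 2 ^ (n + 1) \<in> {1 .. 2 ^ (n + 2) - (1::nat)}" by (simp add: p_def)
    moreover have "real k / s = - 1 + real (k + 2 ^ (n + 1)) / 2 ^ (n + 1)"
      by (simp add: s_def add_divide_distrib)
    ultimately show ?thesis unfolding grid_def by blast
  qed
  have nv: "norm (v k) = cmod (Complex (real k / s) (1 / s))" for k
    by (simp add: v_def norm_vec_def L2_set_def axis_def if_distrib[of norm] if_distrib[of "\<lambda>x. x\<^sup>2"] cong: if_cong)
  have vpos: "norm (v k) > 0" for k
    using s by (auto simp: nv complex_eq_iff)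
  have "u k \<in> ?L" if k: "k \<le> 2 ^ n" for k
  proof -
    have "real k \<le> 2 ^ n" using k by (metis of_nat_le_iff of_nat_numeral of_nat_power)
    then have "real k / s \<le> 1 / 2" by (simp add: s_def field_simps)
    moreover have "1 / s \<le> 1 / 2" by (simp add: s_def field_simps)
    moreover have "norm (v k) \<le> \<bar>real k / s\<bar> + \<bar>1 / s\<bar>"
      unfolding nv by (metis cmod_le complex.sel)
    moreover have "0 \<le> real k / s" "0 \<le> 1 / s" using s by simp_all
    ultimately have "norm (v k) \<le> 1" by linarith
    moreover have "Re (v k $ i) \<in> grid n" "Im (v k $ i) \<in> grid n" for i
      using grid[of k] grid[of 0] grid[of 1] k by (auto simp: v_def axis_def)
    ultimately show ?thesis unfolding layer_def u_def using vpos[of k] by blast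
  qed
  moreover have "inj u"
  proof (rule injI)
    fix k m assume "u k = u m"
    then have "u k $ j = u m $ j" by simp
    then have "Re (u k $ j) = Re (u m $ j)" "Im (u k $ j) = Im (u m $ j)" by simp_all
    then have "real k / norm (v k) = real m / norm (v m)" "norm (v k) = norm (v m)"
      using s vpos[of k] vpos[of m] by (auto simp: u_def v_def axis_def field_simps)
    then show "k = m" using vpos[of m] by simp
  qed
  ultimately have "card {..2 ^ n :: nat} \<le> card ?L"
    using fin by (intro card_inj_on_le[of u]) (auto intro: inj_on_subset)
  then have "n < card ?L" using less_exp[of n] unfolding card_atMost by linarith
  then have "y n \<in> ?L" using L by blast
  then show ?thesis by (auto simp: layer_def beamformers_def)
qed

lemma is_quantizer_vlq:
  fixes y :: "nat \<Rightarrow> complex ^ 't"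
  assumes "layered_enumeration y"
  shows "is_quantizer (vlq \<alpha> y)"
proof -
  have O: "outage_region \<alpha> x \<in> sets borel" for x :: "complex ^ 't"
    unfolding outage_region_def hinner_def
    by (intro borel_open open_Collect_less continuous_intros)
  have "encoding_region \<alpha> y n \<in> sets borel" for n
    unfolding encoding_region_def
    using O by (auto intro!: sets.Un sets.Int sets.countable_INT borel_comp sets.countable_INT')
  moreover have "disjoint_family (encoding_region \<alpha> y)"
  proof -
    have "encoding_region \<alpha> y m \<inter> encoding_region \<alpha> y n = {}" if "m < n" for m n
      using that by (cases "m = 0") (auto simp: encoding_region_def)
    then show ?thesis unfolding disjoint_family_on_def by (metis inf_commute linorder_neqE_nat)
  qed
  moreover have "\<exists>n. h \<in> encoding_region \<alpha> y n" for h
  proof (cases "\<forall>k. h \<in> outage_region \<alpha> (y k)")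
    case True
    then show ?thesis by (intro exI[of _ 0]) (auto simp: encoding_region_def)
  next
    case False
    define n where "n = (LEAST k. h \<notin> outage_region \<alpha> (y k))"
    have "h \<notin> outage_region \<alpha> (y n)" "\<And>k. k < n \<Longrightarrow> h \<in> outage_region \<alpha> (y k)"
      using LeastI_ex[of "\<lambda>k. h \<notin> outage_region \<alpha> (y k)"] not_less_Least False
      unfolding n_def by blast+
    then show ?thesis by (intro exI[of _ n]) (auto simp: encoding_region_def)
  qed
  ultimately show ?thesis
    using layered_enumeration_beamformers[OF assms] bij_bword by (auto simp: is_quantizer_def vlq_def bij_def)
qed

end

theory Submission imports Defs begin

text \<open>The codebook is dense in the unit sphere, so off the null set \<open>\<parallel>h\<parallel>\<^sup>2 = \<alpha>\<close> every channel
  with \<open>\<parallel>h\<parallel>\<^sup>2 \<ge> \<alpha>\<close> is served by some codeword; this gives the outage identity. For the rate,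
  truncating the coordinates of \<open>h / \<parallel>h\<parallel>\<close> to the grid shows that layer \<open>l\<close> captures a fraction
  \<open>1 - 2 t / 2\<^sup>l\<close> of \<open>\<parallel>h\<parallel>\<^sup>2\<close>. A state needing an index beyond layer \<open>l\<close> thus lies in a shell just
  outside the ball \<open>\<parallel>h\<parallel>\<^sup>2 < \<alpha>\<close>, of volume of order \<open>2\<^sup>-\<^sup>l \<alpha>\<^sup>t\<close>, while each layer adds only boundedly
  many bits: summing over \<open>l\<close> gives the term \<open>1 / P\<^sup>t\<close>. The first few layers contribute at most a
  constant times the probability that the beam \<open>y 0\<close> fails, which is of order \<open>\<alpha>\<close>; this is the term
  \<open>1 / P\<close>.\<close>

section \<open>Hermitian inner product: Cauchy-Schwarz and sesquilinearity\<close>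

lemma cmod_hinner_le: "cmod (hinner x h) \<le> norm x * norm h"
proof -
  have "cmod (hinner x h) \<le> (\<Sum>i\<in>UNIV. \<bar>norm (x $ i)\<bar> * \<bar>norm (h $ i)\<bar>)"
    unfolding hinner_def by (rule order_trans[OF norm_sum]) (simp add: norm_mult)
  also have "\<dots> \<le> norm x * norm h"
    unfolding norm_vec_def by (rule L2_set_mult_ineq)
  finally show ?thesis .
qed

lemma cmod_hinner_beamformer_le:
  assumes "x \<in> beamformers"
  shows "(cmod (hinner x h))\<^sup>2 \<le> (norm h)\<^sup>2"
  using cmod_hinner_le[of x h] assms by (intro power_mono) (auto simp: beamformers_def)

lemma hinner_self: "hinner x x = of_real ((norm x)\<^sup>2)"
proof -
  have "hinner x x = of_real (\<Sum>i\<in>UNIV. (norm (x $ i))\<^sup>2)"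
    by (simp add: hinner_def complex_norm_square[symmetric])
  also have "(\<Sum>i\<in>UNIV. (norm (x $ i))\<^sup>2) = (norm x)\<^sup>2"
    by (simp add: norm_vec_def L2_set_def sum_nonneg)
  finally show ?thesis .
qed

lemma hinner_diff_left: "hinner (x - y) h = hinner x h - hinner y h"
  by (simp add: hinner_def left_diff_distrib sum_subtractf)

lemma hinner_add_right: "hinner x (h + k) = hinner x h + hinner x k"
  by (simp add: hinner_def distrib_left sum.distrib)

lemma hinner_scaleR_left: "hinner (c *\<^sub>R x) h = of_real c * hinner x h"
  by (simp add: hinner_def sum_distrib_left scaleR_conv_of_real[where 'a = complex] mult.assoc)

lemma hinner_scaleR_right: "hinner x (c *\<^sub>R h) = of_real c * hinner x h"
  by (simp add: hinner_def sum_distrib_left scaleR_conv_of_real[where 'a = complex] mult.left_commute)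

lemma inner_eq_Re_hinner: "inner x h = Re (hinner x h)"
  by (simp add: inner_vec_def hinner_def inner_complex_def)

lemma outage_region_borel: "outage_region \<alpha> x \<in> sets borel"
  unfolding outage_region_def hinner_def
  by (intro borel_open open_Collect_less continuous_intros)

lemma mem_outage_region_iff:
  assumes "\<alpha> > 0"
  shows "h \<in> outage_region \<alpha> x \<longleftrightarrow> (cmod (hinner x h))\<^sup>2 < \<alpha>"
proof -
  have "cmod (hinner x h) < sqrt \<alpha> \<longleftrightarrow> sqrt ((cmod (hinner x h))\<^sup>2) < sqrt \<alpha>"
    by simp
  then show ?thesis
    unfolding outage_region_def mem_Collect_eq real_sqrt_less_iff .
qed

section \<open>Covering property and size of the codebook layers\<close>

text \<open>Rounding goes towards zero, so moduli never grow. This keeps a rounded unit vector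
  inside the unit ball, as \<open>layer\<close> demands.\<close>

lemma grid_approx:
  fixes a :: real
  assumes "\<bar>a\<bar> \<le> 1"
  obtains g where "g \<in> grid l" "\<bar>g\<bar> \<le> \<bar>a\<bar>" "\<bar>g - a\<bar> \<le> 1 / 2 ^ (l + 1)"
proof -
  define p :: nat where "p = 2 ^ (l + 1)"
  have p: "real p > 0" "real p = 2 ^ (l + 1)" "2 ^ (l + 2) = 2 * p" by (auto simp: p_def)
  \<comment> \<open>Ceiling minus 1 replaces the floor because \<open>grid l\<close> omits 1 and -1:
    modulus 1 is sent to \<open>p - 1\<close>, and \<open>nat\<close> turns the value -1 arising at
    \<open>a = 0\<close> into 0.\<close>
  define m where "m = nat (\<lceil>\<bar>a\<bar> * p\<rceil> - 1)"
  have m: "real m \<le> \<bar>a\<bar> * p" "\<bar>a\<bar> * p - 1 \<le> real m" "m < p"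
  proof -
    have "\<bar>a\<bar> * p \<le> p" using assms p by (simp add: mult_left_le_one_le)
    then have "\<lceil>\<bar>a\<bar> * p\<rceil> \<le> int p" by (simp add: ceiling_le_iff)
    then show "m < p" using p unfolding m_def by linarith
    have "0 \<le> \<bar>a\<bar> * p" using p by simp
    then show "real m \<le> \<bar>a\<bar> * p" "\<bar>a\<bar> * p - 1 \<le> real m" unfolding m_def by linarith+
  qed
  have mg: "real m / p \<in> grid l"
  proof -
    have "m + p \<in> {1 .. 2 ^ (l + 2) - 1}" using m p by auto
    moreover have "real m / p = - 1 + real (m + p) / 2 ^ (l + 1)"
      using p by (simp add: p(2)[symmetric] field_simps)
    ultimately show ?thesis unfolding grid_def by blast
  qed
  have ng: "- (real m / p) \<in> grid l"
  proof -
    have "p - m \<in> {1 .. 2 ^ (l + 2) - 1}" using m p by auto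
    moreover have "- (real m / p) = - 1 + real (p - m) / 2 ^ (l + 1)"
      using p m by (simp add: p(2)[symmetric] of_nat_diff field_simps)
    ultimately show ?thesis unfolding grid_def by blast
  qed
  have le: "real m / p \<le> \<bar>a\<bar>" "\<bar>a\<bar> - 1 / p \<le> real m / p"
  proof -
    show "real m / p \<le> \<bar>a\<bar>" using m(1) p(1) by (simp add: divide_le_eq)
    have "\<bar>a\<bar> - 1 / p = (\<bar>a\<bar> * p - 1) / p" using p(1) by (simp add: diff_divide_distrib)
    also have "\<dots> \<le> real m / p" using m(2) p(1) by (intro divide_right_mono) auto
    finally show "\<bar>a\<bar> - 1 / p \<le> real m / p" .
  qed
  then have le': "\<bar>a\<bar> - 1 / 2 ^ (l + 1) \<le> real m / p" by (simp only: p(2))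
  show thesis
  proof (cases "a \<ge> 0")
    case True
    show thesis by (rule that[OF mg]) (use True le(1) le' p(1) in auto)
  next
    case False
    show thesis by (rule that[OF ng]) (use False le(1) le' p(1) in auto)
  qed
qed

text \<open>Round the direction \<open>x\<close> of \<open>h\<close> towards zero in each
  coordinate. The error \<open>v - x\<close> has norm at most \<open>e\<close>, so by Cauchy-Schwarz
  \<open>v\<close> retains at least \<open>1 - e\<close> of the inner product with \<open>x\<close>;
  as \<open>e\<close> is at most 1/4, \<open>v\<close> is nonzero. Dividing by
  \<open>norm v\<close>, which is at most 1, only helps, and squaring turns \<open>e\<close> into
  \<open>2 * e\<close>.\<close>

lemma layer_cover:
  fixes h :: "complex ^ 't"
  assumes l: "4 * CARD('t) \<le> 2 ^ l"
  obtains y where "y \<in> layer l"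
    and "(1 - 2 * CARD('t) / 2 ^ l) * (norm h)\<^sup>2 \<le> (cmod (hinner y h))\<^sup>2"
proof -
  \<comment> \<open>For \<open>h = 0\<close> any unit vector serves, since both sides of the
    estimate vanish.\<close>
  define x where "x = (if h = 0 then axis undefined 1 else h /\<^sub>R norm h)"
  have x: "norm x = 1" and h: "h = norm h *\<^sub>R x"
    by (auto simp: x_def norm_axis_1)
  define e where "e = real CARD('t) / 2 ^ l"
  have e: "0 \<le> e" "e \<le> 1 / 4"
  proof -
    have "4 * real CARD('t) \<le> 2 ^ l" using l
      by (metis of_nat_le_iff of_nat_mult of_nat_numeral of_nat_power)
    then show "0 \<le> e" "e \<le> 1 / 4" by (auto simp: e_def field_simps)
  qed
  have "\<exists>z. Re z \<in> grid l \<and> Im z \<in> grid l \<and> cmod z \<le> cmod (x $ i) \<and>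
     cmod (z - x $ i) \<le> 2 / 2 ^ (l + 1)" for i
  proof -
    have "cmod (x $ i) \<le> 1" using Finite_Cartesian_Product.norm_nth_le[of x i] x by simp
    then have "\<bar>Re (x $ i)\<bar> \<le> 1" "\<bar>Im (x $ i)\<bar> \<le> 1"
      using abs_Re_le_cmod[of "x $ i"] abs_Im_le_cmod[of "x $ i"] by linarith+
    then obtain a b where a: "a \<in> grid l" "\<bar>a\<bar> \<le> \<bar>Re (x $ i)\<bar>" "\<bar>a - Re (x $ i)\<bar> \<le> 1 / 2 ^ (l + 1)"
      and b: "b \<in> grid l" "\<bar>b\<bar> \<le> \<bar>Im (x $ i)\<bar>" "\<bar>b - Im (x $ i)\<bar> \<le> 1 / 2 ^ (l + 1)"
      by (metis grid_approx)
    have "cmod (Complex a b) \<le> cmod (x $ i)"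
      using a b by (auto simp: cmod_def intro!: add_mono simp: abs_le_square_iff)
    moreover have "cmod (Complex a b - x $ i) \<le> 1 / 2 ^ (l + 1) + 1 / 2 ^ (l + 1)"
      using cmod_le[of "Complex a b - x $ i"] a b by simp
    ultimately show ?thesis using a b by (intro exI[of _ "Complex a b"]) auto
  qed
  then obtain z where z: "Re (z i) \<in> grid l" "Im (z i) \<in> grid l" "cmod (z i) \<le> cmod (x $ i)"
     "cmod (z i - x $ i) \<le> 2 / 2 ^ (l + 1)" for i
    by metis
  define v where "v = (\<chi> i. z i)"
  have "norm v \<le> norm x" by (rule norm_le_componentwise_cart) (simp add: v_def z)
  then have v1: "norm v \<le> 1" using x by simp
  have "norm (v - x) \<le> (\<Sum>i\<in>UNIV. norm ((v - x) $ i))"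
    unfolding norm_vec_def by (rule L2_set_le_sum) simp
  also have "\<dots> \<le> (\<Sum>i\<in>(UNIV :: 't set). 2 / 2 ^ (l + 1))"
    by (rule sum_mono) (use z(4) in \<open>simp add: v_def\<close>)
  also have "\<dots> = e" by (simp add: e_def)
  finally have vx: "norm (v - x) \<le> e" .
  have "cmod (hinner x x) - cmod (hinner v x) \<le> cmod (hinner (v - x) x)"
    by (metis hinner_diff_left norm_minus_commute norm_triangle_ineq2)
  also have "\<dots> \<le> norm (v - x) * norm x" by (rule cmod_hinner_le)
  finally have vxi: "1 - e \<le> cmod (hinner v x)" using vx x by (simp add: hinner_self)
  have v0: "norm v > 0"
  proof (rule ccontr)
    assume "\<not> norm v > 0"
    then have "v = 0" by simp
    then show False using vxi e by (simp add: hinner_def)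
  qed
  let ?y = "v /\<^sub>R norm v"
  have "?y \<in> layer l"
    unfolding layer_def using v0 v1 z by (intro CollectI exI[of _ v]) (auto simp: v_def)
  moreover have "(1 - 2 * CARD('t) / 2 ^ l) * (norm h)\<^sup>2 \<le> (cmod (hinner ?y h))\<^sup>2"
  proof -
    have "1 - e \<le> cmod (hinner v x) / norm v"
    proof -
      have "(1 - e) * norm v \<le> 1 - e" using v1 e by (simp add: mult_left_le)
      then show ?thesis using vxi v0 by (simp add: field_simps)
    qed
    then have "(1 - e)\<^sup>2 \<le> (cmod (hinner v x) / norm v)\<^sup>2" using e by (intro power_mono) auto
    moreover have "1 - 2 * e \<le> (1 - e)\<^sup>2" by (simp add: power2_eq_square algebra_simps)
    ultimately have "(1 - 2 * e) * (norm h)\<^sup>2 \<le> (cmod (hinner v x) / norm v)\<^sup>2 * (norm h)\<^sup>2"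
      by (intro mult_right_mono) auto
    moreover have "cmod (hinner ?y h) = cmod (hinner v x) / norm v * norm h"
      by (subst h) (simp add: hinner_scaleR_left hinner_scaleR_right norm_mult norm_inverse norm_divide field_simps)
    ultimately show ?thesis by (simp add: e_def power_mult_distrib power_divide)
  qed
  ultimately show thesis by (rule that)
qed

text \<open>A codeword is determined by \<open>2 * CARD('t)\<close> real coordinates, each from
  fewer than \<open>2 ^ (l + 2)\<close> grid points. Only the linear growth of the exponent in
  \<open>l\<close> matters later: each layer adds boundedly many bits.\<close>

lemma card_layer_le:
  "card (layer l :: (complex ^ 't) set) \<le> 2 ^ ((l + 2) * (2 * CARD('t)))"
proof -
  let ?C = "(\<lambda>(a, b). Complex a b) ` (grid l \<times> grid l)"
  let ?F = "(UNIV :: 't set) \<rightarrow>\<^sub>E ?C"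
  have fg: "finite (grid l)" by (simp add: grid_def)
  have "card (grid l) \<le> card {1 .. 2 ^ (l + 2) - (1 :: nat)}"
    unfolding grid_def by (rule card_image_le) simp
  then have cg: "card (grid l) \<le> 2 ^ (l + 2)" by simp
  have "card ?C \<le> card (grid l \<times> grid l)" using fg by (intro card_image_le) auto
  also have "\<dots> \<le> 2 ^ (l + 2) * 2 ^ (l + 2)"
    using cg unfolding card_cartesian_product by (intro mult_mono) auto
  also have "\<dots> = 2 ^ ((l + 2) * 2)" by (simp add: power_add[symmetric])
  finally have cC: "card ?C \<le> 2 ^ ((l + 2) * 2)" .
  have fF: "finite ?F" using fg by (intro finite_PiE) auto
  have "layer l \<subseteq> (\<lambda>f. (\<chi> i. f i) /\<^sub>R norm (\<chi> i. f i)) ` ?F"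
  proof
    fix v :: "complex ^ 't" assume "v \<in> layer l"
    then obtain y where y: "v = y /\<^sub>R norm y" "\<And>i. Re (y $ i) \<in> grid l \<and> Im (y $ i) \<in> grid l"
      unfolding layer_def by blast
    have "y $ i \<in> ?C" for i
      using y(2)[of i] by (intro image_eqI[of _ _ "(Re (y $ i), Im (y $ i))"]) auto
    then have "vec_nth y \<in> ?F" by (simp add: PiE_def Pi_def)
    then show "v \<in> (\<lambda>f. (\<chi> i. f i) /\<^sub>R norm (\<chi> i. f i)) ` ?F"
      by (rule rev_image_eqI) (simp add: y(1))
  qed
  then have "card (layer l :: (complex ^ 't) set) \<le> card ?F"
    using fF by (rule surj_card_le[rotated])
  also have "\<dots> = card ?C ^ CARD('t)" by (simp add: card_PiE)
  also have "\<dots> \<le> (2 ^ ((l + 2) * 2)) ^ CARD('t)" using cC by (rule power_mono) simp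
  finally show ?thesis by (simp only: power_mult[symmetric] mult.assoc)
qed

section \<open>The channel law: density bounds and the failure probability of one beam\<close>

lemma sets_channel [simp, measurable_cong]: "sets channel = sets borel"
  by (simp add: channel_def)

lemma space_channel [simp]: "space channel = UNIV"
  by (simp add: channel_def)

lemma emeasure_channel:
  fixes A :: "(complex ^ 't) set"
  assumes "A \<in> sets borel"
  shows "emeasure channel A
    = (\<integral>\<^sup>+h. ennreal (exp (- (norm h)\<^sup>2) / pi ^ CARD('t)) * indicator A h \<partial>lborel)"
  unfolding channel_def using assms by (subst emeasure_density) auto

lemma emeasure_channel_le_lborel:
  fixes A :: "(complex ^ 't) set"
  assumes "A \<in> sets borel"
  shows "emeasure channel A \<le> ennreal (1 / pi ^ CARD('t)) * emeasure lborel A"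
proof -
  have "emeasure channel A \<le> (\<integral>\<^sup>+h. ennreal (1 / pi ^ CARD('t)) * indicator A h \<partial>lborel)"
    unfolding emeasure_channel[OF assms]
    by (intro nn_integral_mono mult_right_mono ennreal_leI divide_right_mono) auto
  also have "\<dots> = ennreal (1 / pi ^ CARD('t)) * emeasure lborel A"
    using assms by (subst nn_integral_cmult_indicator) auto
  finally show ?thesis .
qed

text \<open>A translation by a vector \<open>u\<close> along \<open>x\<close> carries the cylinder
  around 0 into the cylinder around \<open>w\<close>. On it the squared norm grows by at most
  \<open>norm u\<close> squared plus twice \<open>inner u h\<close>, that is by at most 16 + 8 = 24,
  which bounds the loss of density.\<close>

lemma measure_channel_translate_ge:
  fixes x :: "complex ^ 't"
  assumes x: "norm x = 1" and w: "cmod w \<le> 4" and \<alpha>: "0 < \<alpha>" "\<alpha> \<le> 1"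
  shows "exp (- 24) * measure channel (outage_region \<alpha> x)
    \<le> measure channel {h. cmod (hinner x h - w) < sqrt \<alpha>}"
proof -
  interpret prob_space "channel :: (complex ^ 't) measure" by (rule prob_space_channel)
  let ?A = "outage_region \<alpha> x" and ?T = "{h. cmod (hinner x h - w) < sqrt \<alpha>}"
  let ?f = "\<lambda>h :: complex ^ 't. exp (- (norm h)\<^sup>2) / pi ^ CARD('t)"
  \<comment> \<open>The conjugate appears because \<open>hinner\<close> is conjugate-linear in its
    second argument, where \<open>u\<close> has to produce \<open>w\<close>.\<close>
  define u where "u = (\<chi> i. cnj w * x $ i)"
  have T: "?T \<in> sets borel" unfolding hinner_def
    by (intro borel_open open_Collect_less continuous_intros)
  have ux: "hinner x u = w"
  proof -
    have "hinner x u = w * hinner x x" by (simp add: u_def hinner_def sum_distrib_left algebra_simps)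
    then show ?thesis by (simp add: hinner_self x)
  qed
  have uh: "hinner u h = cnj w * hinner x h" for h
    by (simp add: u_def hinner_def sum_distrib_left algebra_simps)
  have nu: "(norm u)\<^sup>2 \<le> 4 ^ 2"
  proof -
    have "of_real ((norm u)\<^sup>2) = cnj w * w" using hinner_self[of u] uh[of u] ux by simp
    then have "of_real ((norm u)\<^sup>2) = (of_real ((cmod w)\<^sup>2) :: complex)"
      by (simp only: complex_norm_square mult.commute)
    then have "(norm u)\<^sup>2 = (cmod w)\<^sup>2" by (simp only: of_real_eq_iff)
    also have "\<dots> \<le> 4 ^ 2" using w by (intro power_mono) auto
    finally show ?thesis .
  qed
  have key: "exp (- 24) * ?f h \<le> ?f (u + h)" if "h \<in> ?A" for h
  proof -
    have "inner u h \<le> cmod (hinner u h)"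
      unfolding inner_eq_Re_hinner by (rule complex_Re_le_cmod)
    also have "\<dots> \<le> 4 * 1"
      unfolding uh norm_mult complex_mod_cnj using w that \<alpha>
      by (intro mult_mono) (auto simp: outage_region_def intro: order_trans[OF less_imp_le])
    finally have "inner u h \<le> 4" by simp
    moreover have "(norm (u + h))\<^sup>2 = (norm u)\<^sup>2 + 2 * inner u h + (norm h)\<^sup>2"
      by (simp add: power2_norm_eq_inner inner_add inner_commute)
    ultimately have "- 24 - (norm h)\<^sup>2 \<le> - (norm (u + h))\<^sup>2" using nu by simp
    then have "exp (- 24) * exp (- (norm h)\<^sup>2) \<le> exp (- (norm (u + h))\<^sup>2)"
      by (simp add: exp_add[symmetric])
    then show ?thesis by (simp add: divide_right_mono)
  qed
  have "ennreal (exp (- 24)) * emeasure channel ?A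
      = (\<integral>\<^sup>+h. ennreal (exp (- 24)) * (ennreal (?f h) * indicator ?A h) \<partial>lborel)"
    unfolding emeasure_channel[OF outage_region_borel]
    using outage_region_borel[of \<alpha> x] by (subst nn_integral_cmult) auto
  also have "\<dots> \<le> (\<integral>\<^sup>+h. ennreal (?f (u + h)) * indicator ?T (u + h) \<partial>lborel)"
  proof (rule nn_integral_mono)
    fix h
    show "ennreal (exp (- 24)) * (ennreal (?f h) * indicator ?A h)
      \<le> ennreal (?f (u + h)) * indicator ?T (u + h)"
    proof (cases "h \<in> ?A")
      case True
      then have "u + h \<in> ?T" by (simp add: hinner_add_right ux outage_region_def)
      then show ?thesis using key[OF True] True by (simp add: ennreal_mult[symmetric] ennreal_leI)
    qed simp
  qed
  \<comment> \<open>Substitution \<open>u + h\<close>, followed by translation invariance of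
    Lebesgue measure.\<close>
  also have "\<dots> = (\<integral>\<^sup>+h. ennreal (?f h) * indicator ?T h \<partial>distr lborel borel ((+) u))"
    using T by (subst nn_integral_distr) auto
  also have "\<dots> = emeasure channel ?T"
    unfolding emeasure_channel[OF T] lborel_distr_plus ..
  finally show ?thesis
    unfolding emeasure_eq_measure by (simp add: ennreal_mult[symmetric])
qed

text \<open>Packing argument: on the order of \<open>1 / \<alpha>\<close> disjoint translates of the cylinder
  \<open>outage_region \<alpha> x\<close> fit into a bounded part of its complex direction \<open>x\<close>, and each carries
  a fixed fraction of its mass. This avoids rotating \<open>x\<close> to a coordinate axis.\<close>

lemma measure_outage_region_le:
  fixes x :: "complex ^ 't"
  assumes x: "norm x = 1" and \<alpha>: "0 < \<alpha>"
  shows "measure channel (outage_region \<alpha> x) \<le> exp 24 * \<alpha>"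
proof -
  interpret prob_space "channel :: (complex ^ 't) measure" by (rule prob_space_channel)
  let ?g = "measure channel (outage_region \<alpha> x)"
  show ?thesis
  proof (cases "\<alpha> \<le> 1")
    case False
    have "?g \<le> 1" by (rule prob_le_1)
    moreover have "1 * 1 \<le> exp 24 * \<alpha>" using False by (intro mult_mono) auto
    ultimately show ?thesis by linarith
  next
    case True
    define s where "s = sqrt \<alpha>"
    have s: "0 < s" "s\<^sup>2 = \<alpha>" using \<alpha> by (auto simp: s_def)
    \<comment> \<open>The centres form an \<open>m\<close> by \<open>m\<close> square lattice of
      spacing \<open>2 * s\<close>. Rounding \<open>1 / s\<close> up keeps each coordinate at most
      2, hence each centre within modulus 4, and still gives at least \<open>1 / \<alpha>\<close>
      centres.\<close>
    define m where "m = nat \<lceil>1 / s\<rceil>"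
    define w where "w = (\<lambda>(j, k). Complex (2 * s * real j) (2 * s * real k))"
    define T where "T = (\<lambda>p :: nat \<times> nat. {h. cmod (hinner x h - w p) < s})"
    let ?I = "{..<m} \<times> {..<m}"
    have T: "T p \<in> sets borel" for p unfolding T_def hinner_def
      by (intro borel_open open_Collect_less continuous_intros)
    have small: "2 * s * real j \<le> 2" if "j < m" for j
    proof -
      have "real j \<le> 1 / s" using that s unfolding m_def by linarith
      then show ?thesis using s by (simp add: field_simps)
    qed
    have "cmod (w p) \<le> 4" if "p \<in> ?I" for p
    proof -
      obtain j k where p: "p = (j, k)" "j < m" "k < m"
        using \<open>p \<in> ?I\<close> by (cases p) auto
      have "cmod (w p) \<le> \<bar>2 * s * real j\<bar> + \<bar>2 * s * real k\<bar>"
        using cmod_le[of "w p"] by (simp add: p w_def)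
      then show ?thesis using small[OF p(2)] small[OF p(3)] s by simp
    qed
    then have "exp (- 24) * ?g \<le> measure channel (T p)" if "p \<in> ?I" for p
      unfolding T_def s_def using measure_channel_translate_ge[OF x _ \<alpha> True] that by blast
    then have "(\<Sum>p\<in>?I. exp (- 24) * ?g) \<le> (\<Sum>p\<in>?I. measure channel (T p))"
      by (rule sum_mono)
    also have "\<dots> = measure channel (\<Union>p\<in>?I. T p)"
    proof (rule finite_measure_finite_Union[symmetric])
      show "disjoint_family_on T ?I"
        unfolding disjoint_family_on_def
      proof (intro ballI impI)
        fix p q :: "nat \<times> nat" assume "p \<noteq> q"
        obtain j k j' k' where pq: "p = (j, k)" "q = (j', k')" by fastforce
        have far: "2 * s \<le> \<bar>2 * s * real a - 2 * s * real b\<bar>" if "a \<noteq> b" for a b :: nat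
        proof -
          have "2 * s * 1 \<le> 2 * s * \<bar>real a - real b\<bar>"
            using that s by (intro mult_left_mono) auto
          then show ?thesis using s by (simp add: abs_mult right_diff_distrib[symmetric])
        qed
        \<comment> \<open>Distinct centres differ by at least \<open>2 * s\<close> in one
          coordinate, so the open discs of radius \<open>s\<close> around them are disjoint.\<close>
        have "2 * s \<le> cmod (w p - w q)"
        proof (cases "j = j'")
          case False
          have "2 * s \<le> \<bar>Re (w p - w q)\<bar>" using far[OF False] by (simp add: pq w_def)
          then show ?thesis using abs_Re_le_cmod order_trans by blast
        next
          case True
          then have "k \<noteq> k'" using \<open>p \<noteq> q\<close> pq by simp
          then have "2 * s \<le> \<bar>Im (w p - w q)\<bar>" using far[of k k'] by (simp add: pq w_def)
          then show ?thesis using abs_Im_le_cmod order_trans by blast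
        qed
        moreover have "cmod (w p - w q) < 2 * s" if "h \<in> T p" "h \<in> T q" for h
          using that norm_triangle_ineq4[of "hinner x h - w q" "hinner x h - w p"] by (simp add: T_def)
        ultimately show "T p \<inter> T q = {}" by (meson disjoint_iff not_less)
      qed
    qed (use T in auto)
    also have "\<dots> \<le> 1" by (rule prob_le_1)
    finally have "real m * real m * (exp (- 24) * ?g) \<le> 1" by simp
    moreover have "1 / \<alpha> \<le> real m * real m"
    proof -
      have "1 / s \<le> real m" unfolding m_def by linarith
      then have "1 / s * (1 / s) \<le> real m * real m" using s by (intro mult_mono) auto
      then show ?thesis using s by (simp add: power2_eq_square)
    qed
    then have "1 / \<alpha> * (exp (- 24) * ?g) \<le> real m * real m * (exp (- 24) * ?g)"
      by (intro mult_right_mono) auto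
    ultimately have "1 / \<alpha> * (exp (- 24) * ?g) \<le> 1" by linarith
    then show ?thesis using \<alpha> by (simp add: exp_minus field_simps)
  qed
qed

section \<open>Probability of thin shells outside the ball\<close>

text \<open>On the unit interval the convex function on the left lies below its chord, which joins
  the values 1 and \<open>2 ^ n\<close>.\<close>

lemma power_one_plus_le:
  fixes x :: real
  assumes "0 \<le> x" "x \<le> 1"
  shows "(1 + x) ^ n \<le> 1 + (2 ^ n - 1) * x"
proof (induction n)
  case (Suc n)
  have "(1 + x) ^ Suc n \<le> (1 + x) * (1 + (2 ^ n - 1) * x)"
    using Suc assms by (simp add: mult_left_mono)
  also have "\<dots> = 1 + 2 ^ n * x + (2 ^ n - 1) * x * x" by (simp add: algebra_simps)
  also have "(2 ^ n - 1) * x * x \<le> (2 ^ n - 1) * x * 1"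
    using assms by (intro mult_left_mono) auto
  finally show ?case by (simp add: algebra_simps)
qed simp

text \<open>The second condition negates the guarantee of \<open>layer_cover\<close> with loss
  \<open>\<delta>\<close>: these are the states outside the ball for which a codeword capturing a
  fraction \<open>1 - \<delta>\<close> of the energy may still fail.\<close>

definition shell :: "real \<Rightarrow> real \<Rightarrow> ('a::euclidean_space) set" where
  "shell \<delta> \<alpha> = {h. \<alpha> \<le> (norm h)\<^sup>2 \<and> (1 - \<delta>) * (norm h)\<^sup>2 < \<alpha>}"

text \<open>The shell lies between the balls of squared radii \<open>\<alpha>\<close> and
  \<open>(1 + 2 * \<delta>) * \<alpha>\<close>. In real dimension \<open>2 * CARD('t)\<close> their
  volumes are multiples of the powers \<open>CARD('t)\<close> of these squared radii, so the
  difference is linear in \<open>\<delta>\<close>; the density is at most its value at 0.\<close>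

lemma emeasure_shell_le:
  assumes \<delta>: "0 \<le> \<delta>" "\<delta> \<le> 1 / 2" and \<alpha>: "0 < \<alpha>"
  shows "emeasure channel (shell \<delta> \<alpha> :: (complex ^ 't) set)
    \<le> ennreal (2 * 2 ^ CARD('t) * unit_ball_vol (2 * CARD('t)) / pi ^ CARD('t) * \<delta> * \<alpha> ^ CARD('t))"
proof -
  let ?t = "CARD('t)" and ?V = "unit_ball_vol (2 * CARD('t))"
  let ?R = "sqrt ((1 + 2 * \<delta>) * \<alpha>)"
  let ?B = "\<lambda>r. ball (0 :: complex ^ 't) r"
  have vol: "emeasure lborel (?B (sqrt a)) = ennreal (?V * a ^ ?t)" if "a \<ge> 0" for a
    using that by (simp add: emeasure_ball power_mult mult.commute[of _ 2])
  have sub: "shell \<delta> \<alpha> \<subseteq> ?B ?R - ?B (sqrt \<alpha>)"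
  proof
    fix h :: "complex ^ 't" assume "h \<in> shell \<delta> \<alpha>"
    then have h: "\<alpha> \<le> (norm h)\<^sup>2" "(1 - \<delta>) * (norm h)\<^sup>2 < \<alpha>" by (auto simp: shell_def)
    \<comment> \<open>This replaces division by \<open>1 - \<delta>\<close> and is where
      \<open>\<delta>\<close> at most 1/2 enters.\<close>
    have "1 \<le> (1 + 2 * \<delta>) * (1 - \<delta>)"
    proof -
      have "\<delta> * \<delta> \<le> \<delta> * (1 / 2)" using \<delta> by (intro mult_left_mono) auto
      then show ?thesis by (simp add: algebra_simps)
    qed
    then have "1 * (norm h)\<^sup>2 \<le> (1 + 2 * \<delta>) * (1 - \<delta>) * (norm h)\<^sup>2" by (intro mult_right_mono) auto
    also have "\<dots> < (1 + 2 * \<delta>) * \<alpha>" using h(2) \<delta> by (simp add: mult.assoc)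
    finally have "(norm h)\<^sup>2 < (1 + 2 * \<delta>) * \<alpha>" by simp
    then have "norm h < ?R" using real_less_rsqrt by blast
    moreover have "sqrt \<alpha> \<le> norm h" using h(1) by (simp add: real_le_lsqrt)
    ultimately show "h \<in> ?B ?R - ?B (sqrt \<alpha>)" by simp
  qed
  have mono: "?B (sqrt \<alpha>) \<subseteq> ?B ?R"
    using \<delta> \<alpha> by (intro subset_ball) (simp add: algebra_simps)
  have diff: "((1 + 2 * \<delta>) * \<alpha>) ^ ?t - \<alpha> ^ ?t \<le> 2 * 2 ^ ?t * \<delta> * \<alpha> ^ ?t"
  proof -
    have "(1 + 2 * \<delta>) ^ ?t \<le> 1 + (2 ^ ?t - 1) * (2 * \<delta>)" using \<delta> by (intro power_one_plus_le) auto
    also have "\<dots> \<le> 1 + 2 ^ ?t * (2 * \<delta>)" using \<delta> by (intro add_left_mono mult_right_mono) auto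
    finally have "((1 + 2 * \<delta>) ^ ?t - 1) * \<alpha> ^ ?t \<le> 2 ^ ?t * (2 * \<delta>) * \<alpha> ^ ?t"
      using \<alpha> by (intro mult_right_mono) auto
    then show ?thesis unfolding power_mult_distrib by (simp only: algebra_simps mult_1_left)
  qed
  have "emeasure lborel (?B ?R - ?B (sqrt \<alpha>)) = emeasure lborel (?B ?R) - emeasure lborel (?B (sqrt \<alpha>))"
    using mono vol[of \<alpha>] \<alpha> by (intro emeasure_Diff) auto
  also have "\<dots> = ennreal (?V * ((1 + 2 * \<delta>) * \<alpha>) ^ ?t - ?V * \<alpha> ^ ?t)"
    using \<delta> \<alpha> by (subst (1 2) vol) (auto intro!: ennreal_minus mult_nonneg_nonneg)
  also have "\<dots> \<le> ennreal (?V * (2 * 2 ^ ?t * \<delta> * \<alpha> ^ ?t))"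
    unfolding right_diff_distrib[symmetric] by (intro ennreal_leI mult_left_mono diff) auto
  finally have diff_vol: "emeasure lborel (?B ?R - ?B (sqrt \<alpha>)) \<le> ennreal (?V * (2 * 2 ^ ?t * \<delta> * \<alpha> ^ ?t))" .
  have "emeasure channel (shell \<delta> \<alpha> :: (complex ^ 't) set) \<le> emeasure channel (?B ?R - ?B (sqrt \<alpha>))"
    using sub by (intro emeasure_mono) auto
  also have "\<dots> \<le> ennreal (1 / pi ^ ?t) * emeasure lborel (?B ?R - ?B (sqrt \<alpha>))"
    by (intro emeasure_channel_le_lborel) auto
  also have "\<dots> \<le> ennreal (1 / pi ^ ?t) * ennreal (?V * (2 * 2 ^ ?t * \<delta> * \<alpha> ^ ?t))"
    by (intro mult_left_mono diff_vol) simp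
  also have "\<dots> = ennreal (1 / pi ^ ?t * (?V * (2 * 2 ^ ?t * \<delta> * \<alpha> ^ ?t)))"
    using \<delta> \<alpha> by (intro ennreal_mult[symmetric]) auto
  finally show ?thesis by (simp add: mult_ac)
qed

lemma shell_borel: "shell \<delta> \<alpha> \<in> sets borel"
  unfolding shell_def by measurable

section \<open>Codeword lengths and the rate bound\<close>

lemma length_bword_le:
  assumes "n < 2 ^ k"
  shows "length (bword n) \<le> k"
proof -
  have "real (n + 1) \<le> 2 ^ k"
    using assms by (metis Suc_eq_plus1 Suc_leI of_nat_le_iff of_nat_numeral of_nat_power)
  then have "log 2 (real (n + 1)) \<le> log 2 (2 ^ k)" by (subst log_le_cancel_iff) auto
  then have "log 2 (real (n + 1)) \<le> real k" by (simp add: log_nat_power)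
  then show ?thesis unfolding length_bword by linarith
qed

lemma encoding_region_borel: "encoding_region \<alpha> y n \<in> sets borel"
  unfolding encoding_region_def using outage_region_borel
  by (auto intro!: sets.Un sets.Int sets.countable_INT borel_comp sets.countable_INT')

text \<open>Success of \<open>y n\<close> forces the norm of \<open>h\<close> out of the ball, while
  all of layer \<open>l\<close> precedes \<open>n\<close> and has failed, including the codeword
  from \<open>layer_cover\<close>. Index 0 is excluded because its region also holds the states that
  no codeword serves.\<close>

lemma encoding_region_subset_shell:
  fixes y :: "nat \<Rightarrow> complex ^ 't"
  assumes y: "layered_enumeration y" and \<alpha>: "\<alpha> > 0" and l: "4 * CARD('t) \<le> 2 ^ l"
    and n: "n > 0" "card (layer l :: (complex ^ 't) set) \<le> n"
  shows "encoding_region \<alpha> y n \<subseteq> shell (2 * CARD('t) / 2 ^ l) \<alpha>"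
proof
  fix h assume "h \<in> encoding_region \<alpha> y n"
  then have h: "h \<notin> outage_region \<alpha> (y n)" "\<And>k. k < n \<Longrightarrow> h \<in> outage_region \<alpha> (y k)"
    using n(1) by (auto simp: encoding_region_def)
  have "\<alpha> \<le> (cmod (hinner (y n) h))\<^sup>2" using h(1) \<alpha> by (simp add: mem_outage_region_iff)
  also have "\<dots> \<le> (norm h)\<^sup>2"
    by (rule cmod_hinner_beamformer_le[OF layered_enumeration_beamformers[OF y]])
  finally have "\<alpha> \<le> (norm h)\<^sup>2" .
  moreover obtain x where x: "x \<in> layer l"
    "(1 - 2 * CARD('t) / 2 ^ l) * (norm h)\<^sup>2 \<le> (cmod (hinner x h))\<^sup>2"
    using layer_cover[OF l, of h] .
  obtain k where "k < card (layer l :: (complex ^ 't) set)" "x = y k"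
    using y x(1) unfolding layered_enumeration_def by (metis imageE lessThan_iff)
  then have "(cmod (hinner x h))\<^sup>2 < \<alpha>" using h(2)[of k] n(2) \<alpha> by (simp add: mem_outage_region_iff)
  ultimately show "h \<in> shell (2 * CARD('t) / 2 ^ l) \<alpha>" using x(2) by (simp add: shell_def)
qed

text \<open>By disjointness of the regions the sum is the probability of a union. The condition is a
  factor \<open>of_bool\<close> so that the terms of the layer-cake bound match directly.\<close>

lemma sum_emeasure_encoding_region_le:
  fixes y :: "nat \<Rightarrow> complex ^ 't"
  assumes y: "layered_enumeration y" and F: "finite F" and S: "S \<in> sets borel"
    and sub: "\<And>n. n \<in> F \<Longrightarrow> Q n \<Longrightarrow> encoding_region \<alpha> y n \<subseteq> S"
  shows "(\<Sum>n\<in>F. emeasure channel (encoding_region \<alpha> y n) * of_bool (Q n)) \<le> emeasure channel S"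
proof -
  have disj: "disjoint_family (encoding_region \<alpha> y)"
    using is_quantizer_vlq[OF y, of \<alpha>] by (simp add: is_quantizer_def vlq_def)
  have "(\<Sum>n\<in>F. emeasure channel (encoding_region \<alpha> y n) * of_bool (Q n))
      = (\<Sum>n | n \<in> F \<and> Q n. emeasure channel (encoding_region \<alpha> y n))"
    by (subst sum.inter_filter[OF F]) (rule sum.cong, auto)
  also have "\<dots> = emeasure channel (\<Union>n\<in>{n \<in> F. Q n}. encoding_region \<alpha> y n)"
    using F disj encoding_region_borel
    by (intro sum_emeasure) (auto intro: disjoint_family_on_mono)
  also have "\<dots> \<le> emeasure channel S"
    using sub S by (intro emeasure_mono) auto
  finally show ?thesis .
qed

text \<open>A layer-cake bound: \<open>n\<close> costs at most \<open>2 * CARD('t)\<close> further bits for each layer it lies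
  beyond, so the rate becomes a sum of tail probabilities.\<close>

lemma length_bword_layer_cake:
  fixes l0 :: nat and B :: nat
  defines "B \<equiv> 2 * CARD('t)"
  shows "of_nat (length (bword n)) \<le> of_nat ((l0 + 2) * B) * of_bool (n > 0)
    + (\<Sum>l. of_nat B * of_bool (n > 0 \<and> card (layer (l0 + l) :: (complex ^ 't) set) \<le> n) :: ennreal)"
proof (cases "n > 0")
  case True
  let ?c = "\<lambda>l. card (layer (l0 + l) :: (complex ^ 't) set)"
  \<comment> \<open>\<open>k\<close> counts layers from \<open>l0\<close> on that end at or before
    index \<open>n\<close>; each of them pays for \<open>B\<close> bits.\<close>
  obtain k where k: "\<And>l. l < k \<Longrightarrow> ?c l \<le> n" "length (bword n) \<le> (l0 + 2) * B + k * B"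
  proof (cases "\<exists>l. n < ?c l")
    case True
    define k where "k = (LEAST l. n < ?c l)"
    have "n < ?c k" unfolding k_def using True by (rule LeastI_ex)
    also have "\<dots> \<le> 2 ^ ((l0 + k + 2) * B)" unfolding B_def by (rule card_layer_le)
    finally have "length (bword n) \<le> (l0 + k + 2) * B" by (rule length_bword_le)
    moreover have "?c l \<le> n" if "l < k" for l
      using not_less_Least that unfolding k_def by (metis not_less)
    ultimately show thesis using that[of k] by (simp add: algebra_simps)
  next
    case False
    \<comment> \<open>If all layers end at or before \<open>n\<close>, every \<open>l\<close> is
      admissible and \<open>k\<close> can be the word length itself, since \<open>B\<close> is at
      least 1.\<close>
    have "length (bword n) \<le> (l0 + 2) * B + length (bword n) * B"
      by (simp add: B_def trans_le_add2)
    then show thesis using that[of "length (bword n)"] False by (auto simp: not_less)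
  qed
  have "(of_nat (length (bword n)) :: ennreal) \<le> of_nat ((l0 + 2) * B) + of_nat (k * B)"
    using k(2) by (metis of_nat_add of_nat_mono)
  also have "(of_nat (k * B) :: ennreal) = (\<Sum>l<k. of_nat B * of_bool (n > 0 \<and> ?c l \<le> n))"
    using True k(1) by simp
  also have "\<dots> \<le> (\<Sum>l. of_nat B * of_bool (n > 0 \<and> ?c l \<le> n))"
    by (rule sum_le_suminf) auto
  finally show ?thesis using True by simp
qed simp

text \<open>After the layer-cake bound the sums over indices and layers are exchanged. The base cost
  of \<open>A\<close> bits is paid only when \<open>y 0\<close> fails, with probability of order
  \<open>\<alpha>\<close>; each further layer costs \<open>B\<close> bits on a shell whose bound
  halves from layer to layer, so a geometric series remains.\<close>

lemma rate_vlq_le: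
  fixes y :: "nat \<Rightarrow> complex ^ 't"
  assumes y: "layered_enumeration y"
  shows "\<exists>K\<ge>0. \<forall>\<alpha>>0. rate (vlq \<alpha> y) \<le> ennreal (K * (\<alpha> + \<alpha> ^ CARD('t)))"
proof -
  let ?t = "CARD('t)"
  define B where "B = 2 * ?t"
  \<comment> \<open>The first layer considered: from here on \<open>4 * CARD('t)\<close> is at most
    \<open>2 ^ l\<close>, as \<open>layer_cover\<close> requires, and the shell parameter is at most
    1/2.\<close>
  define l0 where "l0 = ?t + 2"
  define A where "A = (l0 + 2) * B"
  define D where "D = 2 * 2 ^ ?t * unit_ball_vol (2 * ?t) / pi ^ ?t"
  define \<delta> where "\<delta> l = real (2 * ?t) / 2 ^ (l0 + l)" for l :: nat
  define c where "c l = card (layer (l0 + l) :: (complex ^ 't) set)" for l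
  have D: "D \<ge> 0" by (simp add: D_def)
  have large: "4 * ?t \<le> 2 ^ (l0 + l)" for l
  proof -
    have "4 * ?t \<le> 4 * 2 ^ ?t" using less_exp[of ?t] by simp
    also have "\<dots> \<le> 4 * 2 ^ ?t * 2 ^ l" by simp
    finally show ?thesis by (simp add: l0_def power_add)
  qed
  have \<delta>: "0 \<le> \<delta> l" "\<delta> l \<le> 1 / 2" for l
  proof -
    have "4 * real ?t \<le> 2 ^ (l0 + l)" using large[of l]
      by (metis of_nat_le_iff of_nat_mult of_nat_numeral of_nat_power)
    then show "0 \<le> \<delta> l" "\<delta> l \<le> 1 / 2" by (auto simp: \<delta>_def field_simps)
  qed
  \<comment> \<open>The sum of \<open>B * D * \<delta> l\<close> over all \<open>l\<close>: a
    geometric series of ratio 1/2 is twice its first term.\<close>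
  define M where "M = B * D * (2 * (2 * ?t / 2 ^ l0))"
  have "rate (vlq \<alpha> y) \<le> ennreal ((A * exp 24 + M) * (\<alpha> + \<alpha> ^ ?t))" if \<alpha>: "\<alpha> > 0" for \<alpha>
  proof -
    define g where "g n = emeasure channel (encoding_region \<alpha> y n)" for n
    have y1: "norm (y n) = 1" for n
      using layered_enumeration_beamformers[OF y, of n] by (simp add: beamformers_def)
    interpret prob_space "channel :: (complex ^ 't) measure" by (rule prob_space_channel)
    \<comment> \<open>An infinite sum of nonnegative extended reals is the supremum of its finite
      partial sums, so a bound uniform in \<open>F\<close> suffices.\<close>
    have partial: "(\<Sum>n\<in>F. g n * of_nat (length (bword n))) \<le> ennreal ((A * exp 24 + M) * (\<alpha> + \<alpha> ^ ?t))"
      if F: "finite F" for F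
    proof -
      have "(\<Sum>n\<in>F. g n * of_nat (length (bword n)))
          \<le> (\<Sum>n\<in>F. g n * (of_nat A * of_bool (n > 0) + (\<Sum>l. of_nat B * of_bool (n > 0 \<and> c l \<le> n))))"
        unfolding A_def B_def c_def by (intro sum_mono mult_left_mono length_bword_layer_cake) auto
      also have "\<dots> = of_nat A * (\<Sum>n\<in>F. g n * of_bool (n > 0))
          + (\<Sum>n\<in>F. \<Sum>l. of_nat B * (g n * of_bool (n > 0 \<and> c l \<le> n)))"
        by (simp only: distrib_left sum.distrib sum_distrib_left ennreal_suminf_cmult[symmetric]
            mult.left_commute)
      also have "(\<Sum>n\<in>F. \<Sum>l. of_nat B * (g n * of_bool (n > 0 \<and> c l \<le> n)))
          = (\<Sum>l. of_nat B * (\<Sum>n\<in>F. g n * of_bool (n > 0 \<and> c l \<le> n)))"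
        unfolding sum_distrib_left by (rule suminf_sum[symmetric]) simp
      also have "of_nat A * (\<Sum>n\<in>F. g n * of_bool (n > 0))
          + (\<Sum>l. of_nat B * (\<Sum>n\<in>F. g n * of_bool (n > 0 \<and> c l \<le> n)))
        \<le> of_nat A * ennreal (exp 24 * \<alpha>) + (\<Sum>l. of_nat B * ennreal (D * \<delta> l * \<alpha> ^ ?t))"
      proof (intro add_mono mult_left_mono suminf_le)
        \<comment> \<open>Every region of positive index lies in the outage region of
          \<open>y 0\<close>; index 0 carries the empty word and costs nothing.\<close>
        have "(\<Sum>n\<in>F. g n * of_bool (n > 0)) \<le> emeasure channel (outage_region \<alpha> (y 0))"
          unfolding g_def
          by (rule sum_emeasure_encoding_region_le[OF y F outage_region_borel])
            (auto simp: encoding_region_def)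
        also have "\<dots> \<le> ennreal (exp 24 * \<alpha>)"
          unfolding emeasure_eq_measure by (intro ennreal_leI measure_outage_region_le y1 \<alpha>)
        finally show "(\<Sum>n\<in>F. g n * of_bool (n > 0)) \<le> ennreal (exp 24 * \<alpha>)" .
      next
        fix l
        have "(\<Sum>n\<in>F. g n * of_bool (n > 0 \<and> c l \<le> n)) \<le> emeasure channel (shell (\<delta> l) \<alpha> :: (complex ^ 't) set)"
          unfolding g_def
        proof (rule sum_emeasure_encoding_region_le[OF y F shell_borel])
          fix n assume "n > 0 \<and> c l \<le> n"
          then show "encoding_region \<alpha> y n \<subseteq> shell (\<delta> l) \<alpha>"
            unfolding \<delta>_def c_def using encoding_region_subset_shell[OF y \<alpha> large] by blast
        qed
        also have "\<dots> \<le> ennreal (D * \<delta> l * \<alpha> ^ ?t)"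
          unfolding D_def by (rule emeasure_shell_le[OF \<delta> \<alpha>])
        finally show "(\<Sum>n\<in>F. g n * of_bool (n > 0 \<and> c l \<le> n)) \<le> ennreal (D * \<delta> l * \<alpha> ^ ?t)" .
      qed auto
      also have "(\<Sum>l. of_nat B * ennreal (D * \<delta> l * \<alpha> ^ ?t)) = (\<Sum>l. ennreal (B * (D * \<delta> l * \<alpha> ^ ?t)))"
        by (simp add: ennreal_of_nat_eq_real_of_nat ennreal_mult')
      also have "\<dots> = ennreal (M * \<alpha> ^ ?t)"
      proof (rule suminf_ennreal_eq)
        show "0 \<le> B * (D * \<delta> l * \<alpha> ^ ?t)" for l using D \<delta> \<alpha> by simp
        have "(\<lambda>l. B * D * \<alpha> ^ ?t * (2 * ?t / 2 ^ l0) * (1 / 2) ^ l)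
            sums (B * D * \<alpha> ^ ?t * (2 * ?t / 2 ^ l0) * (1 / (1 - 1 / 2)))"
          by (intro sums_mult geometric_sums) simp
        then show "(\<lambda>l. B * (D * \<delta> l * \<alpha> ^ ?t)) sums (M * \<alpha> ^ ?t)"
          by (simp add: M_def \<delta>_def power_add power_one_over field_simps)
      qed
      also have "of_nat A * ennreal (exp 24 * \<alpha>) + ennreal (M * \<alpha> ^ ?t)
          = ennreal (A * exp 24 * \<alpha> + M * \<alpha> ^ ?t)"
        using \<alpha> D by (simp add: ennreal_of_nat_eq_real_of_nat ennreal_mult'[symmetric] M_def mult.assoc)
      also have "\<dots> \<le> ennreal ((A * exp 24 + M) * (\<alpha> + \<alpha> ^ ?t))"
      proof (rule ennreal_leI)
        have "0 \<le> A * exp 24 * \<alpha> ^ ?t" "0 \<le> M * \<alpha>" using \<alpha> D by (auto simp: M_def)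
        then show "A * exp 24 * \<alpha> + M * \<alpha> ^ ?t \<le> (A * exp 24 + M) * (\<alpha> + \<alpha> ^ ?t)"
          by (simp add: algebra_simps)
      qed
      finally show ?thesis .
    qed
    have "(\<Sum>\<^sub>\<infinity>n. g n * of_nat (length (bword n))) \<le> ennreal ((A * exp 24 + M) * (\<alpha> + \<alpha> ^ ?t))"
      by (rule infsum_le_finite_sums) (auto intro: nonneg_summable_on_complete partial)
    then show ?thesis by (simp only: rate_def vlq_def g_def quantizer.simps)
  qed
  moreover have "0 \<le> A * exp 24 + M" using D by (simp add: M_def)
  ultimately show ?thesis by blast
qed

section \<open>The outage identity\<close>

text \<open>The quantizer is in outage exactly when all codewords fail. That event contains the open
  ball by Cauchy-Schwarz and lies in the closed ball by density of the codebook; the sphere between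
  them is a null set.\<close>

lemma outage_vlq:
  fixes y :: "nat \<Rightarrow> complex ^ 't"
  assumes y: "layered_enumeration y" and \<alpha>: "\<alpha> > 0"
  shows "outage \<alpha> (vlq \<alpha> y) = outage_full TYPE('t) \<alpha>"
proof -
  interpret prob_space "channel :: (complex ^ 't) measure" by (rule prob_space_channel)
  let ?F = "encoding_region \<alpha> y" and ?N = "{h :: complex ^ 't. (norm h)\<^sup>2 < \<alpha>}"
  have Q: "disjoint_family ?F" "(\<Union>n. ?F n) = UNIV"
    using is_quantizer_vlq[OF y, of \<alpha>] by (simp_all add: is_quantizer_def vlq_def)
  have eq: "{h. (cmod (hinner (quantize (vlq \<alpha> y) h) h))\<^sup>2 < \<alpha>} = (\<Inter>k. outage_region \<alpha> (y k))"
  proof (rule set_eqI)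
    fix h
    obtain n where n: "h \<in> ?F n" using Q(2) by blast
    have "(THE n. h \<in> ?F n) = n"
      using n Q(1) by (intro the_equality) (auto simp: disjoint_family_on_def)
    then have "quantize (vlq \<alpha> y) h = y n" by (simp add: quantize_def vlq_def)
    then have "h \<in> {h. (cmod (hinner (quantize (vlq \<alpha> y) h) h))\<^sup>2 < \<alpha>} \<longleftrightarrow> h \<in> outage_region \<alpha> (y n)"
      using \<alpha> by (simp add: mem_outage_region_iff)
    \<comment> \<open>For positive \<open>n\<close> both sides are false, since \<open>y n\<close>
      succeeds on its region. Region 0 consists of the successes of \<open>y 0\<close> and the
      states where every codeword fails.\<close>
    also have "\<dots> \<longleftrightarrow> h \<in> (\<Inter>k. outage_region \<alpha> (y k))"
      using n by (auto simp: encoding_region_def split: if_splits)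
    finally show "h \<in> {h. (cmod (hinner (quantize (vlq \<alpha> y) h) h))\<^sup>2 < \<alpha>}
        \<longleftrightarrow> h \<in> (\<Inter>k. outage_region \<alpha> (y k))" .
  qed
  have low: "?N \<subseteq> (\<Inter>k. outage_region \<alpha> (y k))"
  proof
    fix h :: "complex ^ 't" assume h: "h \<in> ?N"
    have "(cmod (hinner (y k) h))\<^sup>2 < \<alpha>" for k
      using cmod_hinner_beamformer_le[OF layered_enumeration_beamformers[OF y], of k h] h
      unfolding mem_Collect_eq by (rule le_less_trans)
    then show "h \<in> (\<Inter>k. outage_region \<alpha> (y k))" using \<alpha> by (simp add: mem_outage_region_iff)
  qed
  \<comment> \<open>All layers fail on \<open>h\<close>, so the estimate of
    \<open>layer_cover\<close> holds for every large \<open>l\<close>; let \<open>l\<close> tend to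
    infinity.\<close>
  have up: "(norm h)\<^sup>2 \<le> \<alpha>" if h: "h \<in> (\<Inter>k. outage_region \<alpha> (y k))" for h
  proof (rule LIMSEQ_le)
    have "(\<lambda>l. (2 * CARD('t)) * (1 / 2) ^ l :: real) \<longlonglongrightarrow> real (2 * CARD('t)) * 0"
      by (intro tendsto_mult tendsto_const LIMSEQ_realpow_zero) auto
    then have "(\<lambda>l. 2 * CARD('t) / 2 ^ l :: real) \<longlonglongrightarrow> 0" by (simp add: power_divide)
    then have "(\<lambda>l. (1 - 2 * CARD('t) / 2 ^ l) * (norm h)\<^sup>2) \<longlonglongrightarrow> (1 - 0) * (norm h)\<^sup>2"
      by (intro tendsto_mult tendsto_diff tendsto_const)
    then show "(\<lambda>l. (1 - 2 * CARD('t) / 2 ^ l) * (norm h)\<^sup>2) \<longlonglongrightarrow> (norm h)\<^sup>2" by simp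
    have "(1 - 2 * CARD('t) / 2 ^ l) * (norm h)\<^sup>2 \<le> \<alpha>" if l: "l \<ge> CARD('t) + 2" for l
    proof -
      have "4 * CARD('t) \<le> 2 ^ (CARD('t) + 2)" using less_exp[of "CARD('t)"] by simp
      also have "\<dots> \<le> 2 ^ l" using l by (intro power_increasing) auto
      finally obtain x where x: "x \<in> layer l"
        "(1 - 2 * CARD('t) / 2 ^ l) * (norm h)\<^sup>2 \<le> (cmod (hinner x h))\<^sup>2"
        using layer_cover[of l h] by blast
      obtain k where "x = y k" using y x(1) unfolding layered_enumeration_def by blast
      then have "(cmod (hinner x h))\<^sup>2 < \<alpha>" using h \<alpha> by (simp add: mem_outage_region_iff)
      then show ?thesis using x(2) by simp
    qed
    then show "\<exists>L. \<forall>l\<ge>L. (1 - 2 * CARD('t) / 2 ^ l) * (norm h)\<^sup>2 \<le> \<alpha>" by blast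
  qed (rule tendsto_const)
  have null: "AE h in channel. (norm (h :: complex ^ 't))\<^sup>2 \<noteq> \<alpha>"
  proof -
    have "sphere (0 :: complex ^ 't) (sqrt \<alpha>) \<in> null_sets lborel"
      using negligible_sphere[of "0 :: complex ^ 't" "sqrt \<alpha>"]
      by (simp add: null_sets_completion_iff negligible_iff_null_sets)
    then have z: "emeasure lborel (sphere (0 :: complex ^ 't) (sqrt \<alpha>)) = 0" by auto
    have "emeasure channel (sphere (0 :: complex ^ 't) (sqrt \<alpha>)) = 0"
      using emeasure_channel_le_lborel[of "sphere 0 (sqrt \<alpha>) :: (complex ^ 't) set"] z by simp
    then have "sphere (0 :: complex ^ 't) (sqrt \<alpha>) \<in> null_sets channel" by (intro null_setsI) auto
    then show ?thesis
      by (rule AE_I') (use \<alpha> in \<open>auto simp: real_sqrt_unique\<close>)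
  qed
  have "measure channel (\<Inter>k. outage_region \<alpha> (y k)) = measure channel ?N"
  proof (rule measure_eq_AE)
    show "AE h in channel. h \<in> (\<Inter>k. outage_region \<alpha> (y k)) \<longleftrightarrow> h \<in> ?N"
      using null
    proof (rule AE_mp, intro AE_I2 impI)
      fix h :: "complex ^ 't" assume "(norm h)\<^sup>2 \<noteq> \<alpha>"
      then show "h \<in> (\<Inter>k. outage_region \<alpha> (y k)) \<longleftrightarrow> h \<in> ?N"
        using low up[of h] by (auto simp del: INT_iff)
    qed
    show "(\<Inter>k. outage_region \<alpha> (y k)) \<in> sets channel"
      unfolding sets_channel using outage_region_borel by (intro sets.countable_INT) auto
    have "?N \<in> sets borel" by measurable
    then show "?N \<in> sets channel" by simp
  qed
  then show ?thesis unfolding outage_def outage_full_def eq .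
qed

section \<open>Passage from the threshold to the transmit power\<close>

theorem theorem1:
  fixes y :: "nat \<Rightarrow> complex ^ 't" and \<rho> :: real
  assumes "\<rho> > 0"
    and "layered_enumeration y"
  shows "\<exists>C0 \<ge> 0. \<forall>P > 0.
      outage (snr_threshold \<rho> P) (vlq (snr_threshold \<rho> P) y)
        = outage_full TYPE('t) (snr_threshold \<rho> P) \<and>
      rate (vlq (snr_threshold \<rho> P) y) \<le> ennreal (C0 * (1 / P + 1 / P ^ CARD('t)))"
proof -
  obtain K where K: "K \<ge> 0"
    "\<And>\<alpha>. \<alpha> > 0 \<Longrightarrow> rate (vlq \<alpha> y) \<le> ennreal (K * (\<alpha> + \<alpha> ^ CARD('t)))"
    using rate_vlq_le[OF assms(2)] by blast
  define c where "c = 2 powr \<rho> - 1"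
  have c: "c > 0" using assms(1) by (simp add: c_def)
  have "outage (snr_threshold \<rho> P) (vlq (snr_threshold \<rho> P) y)
        = outage_full TYPE('t) (snr_threshold \<rho> P) \<and>
      rate (vlq (snr_threshold \<rho> P) y) \<le> ennreal (K * (c + c ^ CARD('t)) * (1 / P + 1 / P ^ CARD('t)))"
    if P: "P > 0" for P
  proof -
    have \<alpha>: "snr_threshold \<rho> P = c / P" "c / P > 0" using c P by (auto simp: snr_threshold_def c_def)
    have "c / P + (c / P) ^ CARD('t) \<le> (c + c ^ CARD('t)) * (1 / P + 1 / P ^ CARD('t))"
    proof -
      \<comment> \<open>Expanding the product gives the two wanted terms and these two nonnegative
        cross terms.\<close>
      have "0 \<le> c / P ^ CARD('t)" "0 \<le> c ^ CARD('t) / P" using c P by auto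
      then show ?thesis by (simp add: power_divide distrib_left distrib_right add_divide_distrib)
    qed
    then have "K * (c / P + (c / P) ^ CARD('t)) \<le> K * (c + c ^ CARD('t)) * (1 / P + 1 / P ^ CARD('t))"
      using K(1) by (simp only: mult.assoc mult_left_mono)
    then show ?thesis
      unfolding \<alpha>(1) using outage_vlq[OF assms(2) \<alpha>(2)] K(2)[OF \<alpha>(2)]
      by (meson ennreal_leI order_trans)
  qed
  moreover have "K * (c + c ^ CARD('t)) \<ge> 0" using K c by simp
  ultimately show ?thesis by blast
qed

end
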